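(* Consider the problem of scheduling $n$ jobs on a single machine to minimize total completion time, with stochastic job sizes drawn from a distribution $\mathcal{D}$ and bandit feedback. For any $\epsilon>0$ there is an algorithm $\mathcal{A}$ (not depending on $\mathcal{D}$) such that, for every $\mathcal{D}$ and all sufficiently large $T$, $$\mathsf{Regret}_{1+\epsilon}(\mathcal{A},\mathcal{D},T)=O\left(\frac{n^{12}\log^3 T}{\epsilon^4}\right).$$
   Context: There are $n$ jobs with random sizes $P=(P_1,\dots,P_n)\sim\mathcal{D}$, where $\mathcal{D}$ is an unknown distribution supported on $[0,1]^n$ (sizes of different jobs may be correlated). A schedule is a permutation $\pi$ of $[n]$, with job $j$ in position $\pi(j)$. Its cost on sizes $P$ is the total completion time $\mathrm{Cost}(\pi,P)=\sum_{j=1}^n\bigl(P_j+\sum_{j':\pi(j')<\pi(j)}P_{j'}\bigr)=\sum_{j=1}^n(n-\pi(j)+1)P_j$. Let $\mathrm{OPT}=\min_\pi\mathbb{E}_{P\sim\mathcal{D}}[\mathrm{Cost}(\pi,P)]$. In each period $t=1,\dots,T$ the algorithm commits to a schedule $\pi^t$ as a function of past schedules and past observed costs; then $P^t\sim\mathcal{D}$ is drawn independently across periods, and only the number $\mathrm{Cost}(\pi^t,P^t)$ is observed. The algorithm knows $n$, $\epsilon$ and the horizon $T$. For $\gamma\ge1$, $\mathsf{Regret}_\gamma(\mathcal{A},\mathcal{D},T):=\sum_{t=1}^T\mathbb{E}[\mathrm{Cost}(\pi^t,P^t)]-\gamma\,T\,\mathrm{OPT}$. $O(\cdot)$ hides an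 absolute constant. *)

theory Defs
  imports "HOL-Probability.Probability" "HOL-Combinatorics.Combinatorics"
begin

text \<open>Jobs and positions are both numbered \<open>1..n\<close>; job \<open>j\<close> is in position \<open>\<pi> j\<close>.\<close>

type_synonym schedule = "nat \<Rightarrow> nat"

definition schedules :: "nat \<Rightarrow> schedule set" where
  "schedules n = {\<pi>. \<pi> permutes {1..n}}"

definition cost :: "nat \<Rightarrow> schedule \<Rightarrow> (nat \<Rightarrow> real) \<Rightarrow> real" where
  "cost n \<pi> P = (\<Sum>j=1..n. P j + (\<Sum>j' | j' \<in> {1..n} \<and> \<pi> j' < \<pi> j. P j'))"

lemma cost_eq_weighted_sum:
  assumes "\<pi> \<in> schedules n"
  shows "cost n \<pi> P = (\<Sum>j=1..n. (real n - real (\<pi> j) + 1) * P j)"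
proof -
  have perm: "\<pi> permutes {1..n}" using assms by (simp add: schedules_def)
  have card_later: "card {j \<in> {1..n}. \<pi> i < \<pi> j} = n - \<pi> i" for i
  proof -
    have "\<pi> ` {j \<in> {1..n}. \<pi> i < \<pi> j} = {k \<in> \<pi> ` {1..n}. \<pi> i < k}" by blast
    also have "\<dots> = {k \<in> {1..n}. \<pi> i < k}" using permutes_image[OF perm] by simp
    also have "\<dots> = {\<pi> i <.. n}" by auto
    finally have img: "\<pi> ` {j \<in> {1..n}. \<pi> i < \<pi> j} = {\<pi> i <.. n}" .
    have "inj_on \<pi> {j \<in> {1..n}. \<pi> i < \<pi> j}"
      using permutes_inj[OF perm] by (rule inj_on_subset) simp
    from card_image[OF this] show ?thesis by (simp only: img card_greaterThanAtMost)
  qed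
  have "(\<Sum>j=1..n. \<Sum>i | i \<in> {1..n} \<and> \<pi> i < \<pi> j. P i)
      = (\<Sum>i=1..n. \<Sum>j | j \<in> {1..n} \<and> \<pi> i < \<pi> j. P i)"
    by (rule sum.swap_restrict) auto
  also have "\<dots> = (\<Sum>i=1..n. real (n - \<pi> i) * P i)"
    by (simp only: sum_constant card_later)
  also have "\<dots> = (\<Sum>i=1..n. (real n - real (\<pi> i)) * P i)"
  proof (rule sum.cong[OF refl])
    fix i assume "i \<in> {1..n}"
    then have "\<pi> i \<in> {1..n}" using permutes_in_image[OF perm] by blast
    then show "real (n - \<pi> i) * P i = (real n - real (\<pi> i)) * P i" by (simp add: of_nat_diff)
  qed
  finally have "cost n \<pi> P = (\<Sum>j=1..n. P j + (real n - real (\<pi> j)) * P j)"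
    unfolding cost_def by (simp only: sum.distrib)
  then show ?thesis by (simp add: algebra_simps)
qed

text \<open>The coordinates of a size vector may be dependent: \<open>D\<close> is any probability measure on the
  \<open>n\<close>-fold product Borel \<open>\<sigma>\<close>-algebra that is concentrated on the unit cube.\<close>

definition size_distribution :: "nat \<Rightarrow> (nat \<Rightarrow> real) measure \<Rightarrow> bool" where
  "size_distribution n D \<longleftrightarrow>
     prob_space D \<and> sets D = sets (Pi\<^sub>M {1..n} (\<lambda>_. borel)) \<and>
     (AE P in D. \<forall>j\<in>{1..n}. 0 \<le> P j \<and> P j \<le> 1)"

definition opt :: "nat \<Rightarrow> (nat \<Rightarrow> real) measure \<Rightarrow> real" where
  "opt n D = (MIN \<pi>\<in>schedules n. \<integral>P. cost n \<pi> P \<partial>D)"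

text \<open>What the algorithm has seen: the past schedules paired with their observed costs, oldest
  first.\<close>

type_synonym history = "(schedule \<times> real) list"

text \<open>An algorithm maps the horizon and the history to the next schedule. For every sequence of
  past schedules this map must be measurable in the past costs. Without that requirement the
  expected costs below need not exist, and the Bochner integral would silently give them the
  value 0. Being a measurable map into \<open>schedules n\<close> also says that the chosen schedule is a
  permutation.\<close>

definition bandit_algorithm :: "nat \<Rightarrow> (nat \<Rightarrow> history \<Rightarrow> schedule) \<Rightarrow> bool" where
  "bandit_algorithm n A \<longleftrightarrow>
     (\<forall>T k \<sigma>. (\<forall>i<k. \<sigma> i \<in> schedules n) \<longrightarrow>
       (\<lambda>c. A T (map (\<lambda>i. (\<sigma> i, c i)) [0..<k]))
         \<in> Pi\<^sub>M {..<k} (\<lambda>_. borel :: real measure) \<rightarrow>\<^sub>M count_space (schedules n))"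

text \<open>\<open>\<omega> t\<close> is the size vector drawn in period \<open>t \<ge> 1\<close>; \<open>run n a \<omega> t\<close> is the history after \<open>t\<close>
  periods.\<close>

fun run :: "nat \<Rightarrow> (history \<Rightarrow> schedule) \<Rightarrow> (nat \<Rightarrow> nat \<Rightarrow> real) \<Rightarrow> nat \<Rightarrow> history" where
  "run n a \<omega> 0 = []"
| "run n a \<omega> (Suc t) =
     (let h = run n a \<omega> t; \<pi> = a h in h @ [(\<pi>, cost n \<pi> (\<omega> (Suc t)))])"

definition schedule_at :: "nat \<Rightarrow> (history \<Rightarrow> schedule) \<Rightarrow> (nat \<Rightarrow> nat \<Rightarrow> real) \<Rightarrow> nat \<Rightarrow> schedule" where
  "schedule_at n a \<omega> t = a (run n a \<omega> (t - 1))"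

definition regret ::
  "nat \<Rightarrow> real \<Rightarrow> (nat \<Rightarrow> history \<Rightarrow> schedule) \<Rightarrow> (nat \<Rightarrow> real) measure \<Rightarrow> nat \<Rightarrow> real" where
  "regret n \<gamma> A D T =
     (\<Sum>t=1..T. \<integral>\<omega>. cost n (schedule_at n (A T) \<omega> t) (\<omega> t) \<partial>(Pi\<^sub>M {1..T} (\<lambda>_. D)))
     - \<gamma> * real T * opt n D"

end

theory Submission
  imports Defs
begin

text \<open>All \<open>n!\<close> schedules are treated as arms of a bandit. They are played in turn until, at the end
  of a round, the total observed cost reaches \<open>B = (2 / \<eta>) * ln T\<close>; from then on the empirically
  cheapest arm is played. Exploration costs at most \<open>B\<close> plus one round, whatever the distribution.
  The expected costs of any two schedules differ by a factor of at most \<open>n\<close>. Hence, if arm \<open>i\<close> is worse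
  than \<open>1 + \<epsilon>\<close> times the best arm \<open>b\<close>, there are constants \<open>\<eta>\<close> and \<open>\<theta>\<close> depending only on \<open>n\<close> and
  \<open>\<epsilon>\<close> such that \<open>exp (\<eta> * total + \<theta> * (S b - S i))\<close> has expectation at most 1 after any number of
  rounds, where \<open>S a\<close> is the cumulative cost of arm \<open>a\<close>. Committing to \<open>i\<close> makes this quantity at
  least \<open>exp (\<eta> * B)\<close>, so Markov's inequality and a union bound over the stopping round bound its
  probability by \<open>O(1 / T)\<close>. The regret is therefore \<open>O(ln T)\<close> with a constant depending on \<open>n\<close> and \<open>\<epsilon>\<close>,
  and the threshold on \<open>T\<close> may depend on them as well.\<close>

subsection \<open>Stopping and committing\<close>

text \<open>The total is tested only at ends of rounds, when all arms have been played equally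
  often. Quantifying over all past rounds makes the property monotone in \<open>k\<close> for costs
  of any sign.\<close>

definition stopped :: "nat \<Rightarrow> real \<Rightarrow> (nat \<Rightarrow> real) \<Rightarrow> nat \<Rightarrow> bool" where
  "stopped K B c k \<longleftrightarrow> (\<exists>q. q * K \<le> k \<and> B \<le> (\<Sum>s<q * K. c s))"

text \<open>Time does not enter, so the arm committed to stays fixed once the rule has stopped. The
  value is arbitrary if \<open>B\<close> is never reached; \<open>arm_choice\<close> consults it
  only after stopping.\<close>

definition stop_round :: "nat \<Rightarrow> real \<Rightarrow> (nat \<Rightarrow> real) \<Rightarrow> nat" where
  "stop_round K B c = (LEAST q. B \<le> (\<Sum>s<q * K. c s))"

definition arm_total :: "nat \<Rightarrow> nat \<Rightarrow> (nat \<Rightarrow> real) \<Rightarrow> nat \<Rightarrow> real" where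
  "arm_total K q c a = (\<Sum>s | s < q * K \<and> s mod K = a. c s)"

definition best_arm :: "nat \<Rightarrow> nat \<Rightarrow> (nat \<Rightarrow> real) \<Rightarrow> nat" where
  "best_arm K q c = (LEAST a. a < K \<and> (\<forall>b<K. arm_total K q c a \<le> arm_total K q c b))"

definition arm_choice :: "nat \<Rightarrow> real \<Rightarrow> (nat \<Rightarrow> real) \<Rightarrow> nat \<Rightarrow> nat" where
  "arm_choice K B c k =
     (if stopped K B c k then best_arm K (stop_round K B c) c else k mod K)"

lemma stopped_mono: "stopped K B c i \<Longrightarrow> i \<le> k \<Longrightarrow> stopped K B c k"
  unfolding stopped_def by (meson le_trans)

lemma best_arm_props:
  assumes "K > 0"
  shows "best_arm K q c < K" "b < K \<Longrightarrow> arm_total K q c (best_arm K q c) \<le> arm_total K q c b"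
proof -
  have "\<exists>a\<in>{..<K}. \<forall>b\<in>{..<K}. arm_total K q c a \<le> arm_total K q c b"
    using ex_min_if_finite[of "arm_total K q c ` {..<K}"] assms
    by (auto simp: not_less)
  then have "\<exists>a. a < K \<and> (\<forall>b<K. arm_total K q c a \<le> arm_total K q c b)" by auto
  from LeastI_ex[OF this]
  show "best_arm K q c < K" "b < K \<Longrightarrow> arm_total K q c (best_arm K q c) \<le> arm_total K q c b"
    unfolding best_arm_def by auto
qed

lemma arm_choice_less: "K > 0 \<Longrightarrow> arm_choice K B c k < K"
  unfolding arm_choice_def by (auto intro: best_arm_props)

lemma stop_round_props:
  assumes "stopped K B c k"
  shows "stop_round K B c * K \<le> k" "B \<le> (\<Sum>s<stop_round K B c * K. c s)"
proof -
  obtain q where q: "q * K \<le> k" "B \<le> (\<Sum>s<q * K. c s)"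
    using assms unfolding stopped_def by blast
  have "stop_round K B c \<le> q"
    unfolding stop_round_def using q(2) by (rule Least_le)
  then show "stop_round K B c * K \<le> k"
    using q(1) by (meson le_trans mult_le_mono1)
  show "B \<le> (\<Sum>s<stop_round K B c * K. c s)"
    unfolding stop_round_def using q(2) by (rule LeastI)
qed

text \<open>Up to the stopping round the two sequences agree, so both stop at the same round and with
  the same totals.\<close>

lemma arm_choice_adaptive:
  assumes agree: "\<And>i. i < k \<Longrightarrow> \<not> stopped K B X i \<Longrightarrow> c i = X i"
  shows "arm_choice K B c k = arm_choice K B X k"
proof -
  \<comment> \<open>The prefix of length \<open>r\<close> decides the choice at time
    \<open>k\<close>: it ends with the stopping round if that has been reached. No index below
    \<open>r\<close> is stopped, so both sequences agree there.\<close>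
  define r where "r = (if stopped K B X k then stop_round K B X * K else k)"
  have rk: "r \<le> k" unfolding r_def using stop_round_props(1)[of K B X k] by auto
  have eq: "c i = X i" if "i < r" for i
  proof (rule agree)
    show "i < k" using that rk by simp
    show "\<not> stopped K B X i"
    proof
      assume st: "stopped K B X i"
      then have "stopped K B X k" using \<open>i < k\<close> by (simp add: stopped_mono)
      then have "i < stop_round K B X * K" using that r_def by simp
      with stop_round_props(1)[OF st] show False by simp
    qed
  qed
  have sums: "(\<Sum>s<q * K. c s) = (\<Sum>s<q * K. X s)" if "q * K \<le> r" for q
    using that by (intro sum.cong refl eq) simp
  show ?thesis
  proof (cases "stopped K B X k")
    case False
    then have "r = k" by (simp add: r_def)
    then have "\<not> stopped K B c k" using False sums unfolding stopped_def by metis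
    with False show ?thesis by (simp add: arm_choice_def)
  next
    case True
    let ?q = "stop_round K B X"
    have r: "r = ?q * K" using True by (simp add: r_def)
    have B: "B \<le> (\<Sum>s<?q * K. c s)" using stop_round_props(2)[OF True] sums r by simp
    have stc: "stopped K B c k" unfolding stopped_def using B rk r by blast
    have "stop_round K B c = ?q"
      unfolding stop_round_def[of K B c]
    proof (rule Least_equality)
      show "B \<le> (\<Sum>s<?q * K. c s)" by (rule B)
      fix q assume q: "B \<le> (\<Sum>s<q * K. c s)"
      show "?q \<le> q"
      proof (rule ccontr)
        assume "\<not> ?q \<le> q"
        then have "q * K \<le> r" unfolding r by simp
        then have "B \<le> (\<Sum>s<q * K. X s)" using q sums by simp
        then have "?q \<le> q" unfolding stop_round_def by (rule Least_le)
        with \<open>\<not> ?q \<le> q\<close> show False by simp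
      qed
    qed
    moreover have "arm_total K ?q c = arm_total K ?q X"
      unfolding arm_total_def by (intro ext sum.cong refl eq) (auto simp: r)
    ultimately show ?thesis using True stc by (simp add: arm_choice_def best_arm_def)
  qed
qed

lemma stopped_cong:
  assumes "\<And>i. i < k \<Longrightarrow> c i = X i"
  shows "stopped K B c k \<longleftrightarrow> stopped K B X k"
proof -
  have "(\<Sum>s<q * K. c s) = (\<Sum>s<q * K. X s)" if "q * K \<le> k" for q
    using that by (intro sum.cong refl assms) simp
  then show ?thesis unfolding stopped_def by (auto 4 3)
qed

section \<open>Measurability of the stopping rule and of the chosen arm\<close>

lemma stopped_measurable:
  assumes "\<And>s. s < k \<Longrightarrow> (\<lambda>x. Z x s) \<in> borel_measurable N"
  shows "Measurable.pred N (\<lambda>x. stopped K B (Z x) k)"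
proof -
  \<comment> \<open>Only the coordinates below \<open>k\<close> are known to be measurable. Padding
    with zeros makes all of them measurable and leaves the stopping decision at \<open>k\<close>
    unchanged.\<close>
  define W where "W x s = (if s < k then Z x s else 0)" for x s
  have [measurable]: "(\<lambda>x. W x s) \<in> borel_measurable N" for s
    unfolding W_def using assms by (cases "s < k") auto
  have "stopped K B (Z x) k = stopped K B (W x) k" for x
    by (rule stopped_cong) (simp add: W_def)
  then show ?thesis unfolding stopped_def[of K B "W _"] by simp
qed

lemma arm_choice_measurable:
  assumes "\<And>s. s < k \<Longrightarrow> (\<lambda>x. Z x s) \<in> borel_measurable N"
  shows "(\<lambda>x. arm_choice K B (Z x) k) \<in> N \<rightarrow>\<^sub>M count_space UNIV"
proof -
  define W where "W x s = (if s < k then Z x s else 0)" for x s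
  have W [measurable]: "(\<lambda>x. W x s) \<in> borel_measurable N" for s
    unfolding W_def using assms by (cases "s < k") auto
  have eq: "arm_choice K B (Z x) k = arm_choice K B (W x) k" for x
    by (rule arm_choice_adaptive) (simp add: W_def)
  have [measurable]: "Measurable.pred N (\<lambda>x. stopped K B (W x) k)"
    by (rule stopped_measurable) (rule W)
  have [measurable]: "(\<lambda>x. best_arm K q (W x)) \<in> N \<rightarrow>\<^sub>M count_space UNIV" for q
    unfolding best_arm_def arm_total_def by measurable
  have [measurable]: "(\<lambda>x. stop_round K B (W x)) \<in> N \<rightarrow>\<^sub>M count_space UNIV"
    unfolding stop_round_def by measurable
  have [measurable]: "(\<lambda>x. best_arm K (stop_round K B (W x)) (W x)) \<in> N \<rightarrow>\<^sub>M count_space UNIV"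
    by (rule measurable_compose_countable[where f="\<lambda>q x. best_arm K q (W x)"]) measurable
  show ?thesis unfolding eq unfolding arm_choice_def by measurable
qed

text \<open>Let \<open>k\<close> be the last period before stopping and \<open>q * K\<close> the
  last round end up to \<open>k\<close>. The total before \<open>q * K\<close> is still below
  \<open>B\<close>, and at most \<open>K\<close> further periods follow, each costing at most
  \<open>M\<close>.\<close>

lemma exploration_cost_le:
  assumes K: "K > 0" and B: "B \<ge> 0" and M: "M \<ge> 0"
    and X: "\<And>s. s < T \<Longrightarrow> 0 \<le> X s \<and> X s \<le> M"
  shows "(\<Sum>k<T. if stopped K B X k then 0 else X k) \<le> B + real K * M"
proof -
  define E where "E = {k \<in> {..<T}. \<not> stopped K B X k}"
  have "(\<Sum>k<T. if stopped K B X k then 0 else X k) = (\<Sum>k\<in>E. X k)"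
    unfolding E_def by (subst sum.inter_filter) (auto intro: sum.cong)
  also have "\<dots> \<le> B + real K * M"
  proof (cases "E = {}")
    case True
    then show ?thesis using B M by simp
  next
    case False
    define k where "k = Max E"
    have fin: "finite E" unfolding E_def by simp
    have kE: "k \<in> E" unfolding k_def using fin False by (rule Max_in)
    then have kT: "k < T" and ns: "\<not> stopped K B X k" unfolding E_def by auto
    define q where "q = k div K"
    have qk: "q * K \<le> k" unfolding q_def by simp
    have kq: "k < q * K + K"
      unfolding q_def using K by (metis add.commute dividend_less_div_times)
    have "(\<Sum>k\<in>E. X k) \<le> (\<Sum>s\<in>{..k}. X s)"
    proof (rule sum_mono2)
      show "E \<subseteq> {..k}" using fin unfolding k_def by auto
    qed (use X kT in auto)
    also have "{..k} = {..<q * K} \<union> {q * K..k}" using qk by auto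
    also have "(\<Sum>s\<in>{..<q * K} \<union> {q * K..k}. X s) = (\<Sum>s<q * K. X s) + (\<Sum>s=q * K..k. X s)"
      by (rule sum.union_disjoint) auto
    also have "(\<Sum>s<q * K. X s) \<le> B"
      using ns qk unfolding stopped_def by (meson linear)
    also have "(\<Sum>s=q * K..k. X s) \<le> real (card {q * K..k}) * M"
      by (rule sum_bounded_above) (use X kT in auto)
    also have "\<dots> \<le> real K * M"
      by (rule mult_right_mono) (use kq M in auto)
    finally show ?thesis by simp
  qed
  finally show ?thesis .
qed

subsection \<open>Arms with bounded random costs\<close>

text \<open>For negative \<open>x\<close> put \<open>y = - x\<close>; then 1 \<le> 1 + y^3 = (1 - y
  + y^2)(1 + y) \<le> (1 - y + y^2) exp y.\<close>

lemma exp_le_quadratic: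
  fixes x :: real
  assumes "\<bar>x\<bar> \<le> 1"
  shows "exp x \<le> 1 + x + x\<^sup>2"
proof (cases "0 \<le> x")
  case True
  then show ?thesis using assms by (intro exp_bound) auto
next
  case False
  define y where "y = - x"
  have y: "0 < y" using False by (simp add: y_def)
  have pos: "0 < 1 - y + y\<^sup>2"
    using zero_le_power2[of "y - 1"] y by (simp add: power2_eq_square algebra_simps)
  have "1 \<le> 1 + y ^ 3" using y by simp
  also have "\<dots> = (1 - y + y\<^sup>2) * (1 + y)" by (simp add: power2_eq_square power3_eq_cube algebra_simps)
  also have "\<dots> \<le> (1 - y + y\<^sup>2) * exp y"
    using pos exp_ge_add_one_self[of y] by (intro mult_left_mono) auto
  finally have "1 * exp (- y) \<le> (1 - y + y\<^sup>2) * exp y * exp (- y)"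
    by (intro mult_right_mono) auto
  then have "exp (- y) \<le> 1 - y + y\<^sup>2" by (simp add: mult.assoc flip: exp_add)
  then show ?thesis by (simp add: y_def)
qed

text \<open>Fubini: the first argument of \<open>F\<close> ignores coordinate \<open>t\<close>, so
  it can be frozen while \<open>\<omega> t\<close> is averaged out. This turns the cost after
  commitment into the mean of the chosen arm.\<close>

lemma integral_PiM_fresh_coordinate:
  fixes F :: "('i \<Rightarrow> 'b) \<Rightarrow> 'b \<Rightarrow> real"
  assumes D: "prob_space D" and I: "finite I" "t \<in> I"
    and upd: "\<And>x y z. F (x(t := z)) y = F x y"
    and int: "integrable (Pi\<^sub>M I (\<lambda>_. D)) (\<lambda>\<omega>. F \<omega> (\<omega> t))"
    and int': "integrable (Pi\<^sub>M I (\<lambda>_. D)) (\<lambda>\<omega>. \<integral>y. F \<omega> y \<partial>D)"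
  shows "(\<integral>\<omega>. F \<omega> (\<omega> t) \<partial>(Pi\<^sub>M I (\<lambda>_. D))) = (\<integral>\<omega>. \<integral>y. F \<omega> y \<partial>D \<partial>(Pi\<^sub>M I (\<lambda>_. D)))"
proof -
  interpret D: prob_space D by (rule D)
  interpret P: product_sigma_finite "\<lambda>_::'i. D" by standard
  define J where "J = I - {t}"
  have ins: "I = insert t J" and J: "finite J" "t \<notin> J" using I by (auto simp: J_def)
  have "(\<integral>\<omega>. F \<omega> (\<omega> t) \<partial>(Pi\<^sub>M I (\<lambda>_. D))) = (\<integral>x. \<integral>y. F x y \<partial>D \<partial>(Pi\<^sub>M J (\<lambda>_. D)))"
    using P.product_integral_insert[OF J int[unfolded ins]] by (simp add: ins upd)
  also have "\<dots> = (\<integral>\<omega>. \<integral>y. F \<omega> y \<partial>D \<partial>(Pi\<^sub>M I (\<lambda>_. D)))"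
    using P.product_integral_insert[OF J int'[unfolded ins]] by (simp add: ins upd D.prob_space)
  finally show ?thesis .
qed

section \<open>The round-robin cost process and its exponential moments\<close>

text \<open>\<open>Y a y\<close> is the cost of arm \<open>a\<close> on outcome \<open>y\<close>.
  All arms share the outcome and may be dependent; the argument rests on independence between
  periods.\<close>

locale round_robin = prob_space D for D :: "'b measure" +
  fixes Y :: "nat \<Rightarrow> 'b \<Rightarrow> real" and M :: real and K :: nat
  assumes K_pos: "K > 0" and M_pos: "M > 0"
    and Y_measurable [measurable]: "\<And>a. Y a \<in> borel_measurable D"
    and Y_bound: "AE y in D. \<forall>a. 0 \<le> Y a y \<and> Y a y \<le> M"
begin

definition mean :: "nat \<Rightarrow> real" where
  "mean a = expectation (Y a)"

text \<open>These are the costs of round robin continued past the stopping time. Unlike the costs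
  actually paid they are independent under \<open>draws\<close>, and \<open>arm_choice\<close>
  cannot tell the two sequences apart. Entry \<open>s\<close> belongs to period
  \<open>Suc s\<close>.\<close>

definition explored :: "(nat \<Rightarrow> 'b) \<Rightarrow> nat \<Rightarrow> real" where
  "explored \<omega> s = Y (s mod K) (\<omega> (Suc s))"

abbreviation draws :: "nat \<Rightarrow> (nat \<Rightarrow> 'b) measure" where
  "draws T \<equiv> Pi\<^sub>M {1..T} (\<lambda>_. D)"

lemma Y_integrable: "integrable D (Y a)"
  by (rule integrable_const_bound[where B=M]) (use Y_bound in auto)

lemma mean_nonneg: "0 \<le> mean a"
  unfolding mean_def by (rule integral_nonneg_AE) (use Y_bound in auto)

lemma mean_le: "mean a \<le> M"
proof -
  have "mean a \<le> (\<integral>y. M \<partial>D)"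
    unfolding mean_def by (rule integral_mono_AE) (use Y_bound Y_integrable in auto)
  then show ?thesis by (simp add: prob_space)
qed

lemma exp_Y_integrable: "integrable D (\<lambda>y. exp (c * Y a y))"
proof (rule integrable_const_bound[where B="exp (\<bar>c\<bar> * M)"])
  show "AE y in D. norm (exp (c * Y a y)) \<le> exp (\<bar>c\<bar> * M)"
    using Y_bound
  proof eventually_elim
    case (elim y)
    have "c * Y a y \<le> \<bar>c\<bar> * Y a y" using elim by (intro mult_right_mono) auto
    also have "\<dots> \<le> \<bar>c\<bar> * M" using elim by (intro mult_left_mono) auto
    finally show ?case by simp
  qed
qed measurable

text \<open>The quadratic term is controlled by Y^2 \<le> M Y. The whole exponent is therefore
  proportional to the mean, which matters when all means are tiny.\<close>

lemma exp_Y_integral_le: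
  assumes "\<bar>c\<bar> * M \<le> 1"
  shows "expectation (\<lambda>y. exp (c * Y a y)) \<le> exp (c * mean a + c\<^sup>2 * M * mean a)"
proof -
  have "expectation (\<lambda>y. exp (c * Y a y)) \<le> expectation (\<lambda>y. 1 + (c + c\<^sup>2 * M) * Y a y)"
  proof (rule integral_mono_AE)
    show "AE y in D. exp (c * Y a y) \<le> 1 + (c + c\<^sup>2 * M) * Y a y"
      using Y_bound
    proof eventually_elim
      case (elim y)
      then have Y: "0 \<le> Y a y" "Y a y \<le> M" by auto
      have "\<bar>c * Y a y\<bar> \<le> \<bar>c\<bar> * M"
        using Y by (simp add: abs_mult mult_left_mono)
      then have "exp (c * Y a y) \<le> 1 + c * Y a y + (c * Y a y)\<^sup>2"
        using assms by (intro exp_le_quadratic) simp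
      also have "(c * Y a y)\<^sup>2 \<le> c\<^sup>2 * (M * Y a y)"
        using Y by (simp add: power_mult_distrib power2_eq_square[of "Y a y"] mult_left_mono mult_right_mono)
      finally show ?case by (simp add: algebra_simps)
    qed
  qed (use Y_integrable exp_Y_integrable in auto)
  also have "\<dots> = 1 + (c + c\<^sup>2 * M) * mean a"
    using Y_integrable by (simp add: mean_def prob_space)
  also have "\<dots> \<le> exp ((c + c\<^sup>2 * M) * mean a)" by (rule exp_ge_add_one_self)
  finally show ?thesis by (simp add: algebra_simps)
qed

lemma sum_periodic: "(\<Sum>s<q * K. h (s mod K)) = real q * (\<Sum>a<K. h a :: real)"
proof -
  have "(\<Sum>s<q * K. h (s mod K)) = (\<Sum>m<q. \<Sum>s=m * K..<m * K + K. h (s mod K))"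
    by (simp add: sum.nat_group)
  also have "\<dots> = (\<Sum>m<q. \<Sum>a<K. h a)"
  proof (rule sum.cong[OF refl])
    fix m
    have "(\<Sum>s=m * K..<m * K + K. h (s mod K)) = (\<Sum>s=0 + m * K..<K + m * K. h (s mod K))"
      by (simp add: add.commute)
    also have "\<dots> = (\<Sum>a=0..<K. h ((a + m * K) mod K))"
      by (rule sum.shift_bounds_nat_ivl)
    also have "\<dots> = (\<Sum>a<K. h a)" by (simp add: atLeast0LessThan)
    finally show "(\<Sum>s=m * K..<m * K + K. h (s mod K)) = (\<Sum>a<K. h a)" .
  qed
  finally show ?thesis by simp
qed

lemma draws_prob_space: "prob_space (draws T)"
  by (rule prob_space_PiM) (rule prob_space_axioms)

text \<open>Periods are independent, so the expectation factors. By \<open>exp_Y_integral_le\<close>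
  each full round contributes at most the exponential of the drift, hence at most 1.\<close>

lemma exp_explored:
  assumes qT: "q * K \<le> T"
    and c: "\<And>a. \<bar>c a\<bar> * M \<le> 1"
    and drift: "(\<Sum>a<K. c a * mean a + (c a)\<^sup>2 * M * mean a) \<le> 0"
  shows "integrable (draws T) (\<lambda>\<omega>. exp (\<Sum>s<q * K. c (s mod K) * explored \<omega> s))" (is ?int)
    and "(\<integral>\<omega>. exp (\<Sum>s<q * K. c (s mod K) * explored \<omega> s) \<partial>draws T) \<le> 1" (is ?le)
proof -
  interpret P: product_sigma_finite "\<lambda>_::nat. D" by standard
  \<comment> \<open>Periods after the first \<open>q * K\<close> get the factor 1, so the product
    runs over all coordinates of \<open>draws T\<close>. The shift \<open>t - 1\<close> translates
    periods, counted from 1, into indices counted from 0.\<close>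
  define g where
    "g t y = (if t - 1 < q * K then exp (c ((t - 1) mod K) * Y ((t - 1) mod K) y) else 1)" for t y
  have restrict: "(\<Prod>k<T. if k < q * K then f k else 1) = (\<Prod>k<q * K. f k :: real)" for f
  proof -
    have "{k \<in> {..<T}. k < q * K} = {..<q * K}" using qT by auto
    then show ?thesis by (subst prod.inter_filter[symmetric]) auto
  qed
  have eq: "exp (\<Sum>s<q * K. c (s mod K) * explored \<omega> s) = (\<Prod>t\<in>{1..T}. g t (\<omega> t))" for \<omega>
    by (simp add: prod.atLeast1_atMost_eq g_def restrict exp_sum explored_def)
  have g: "integrable D (g t)" for t
    unfolding g_def using exp_Y_integrable by (cases "t - 1 < q * K") auto
  show ?int unfolding eq by (rule P.product_integrable_prod) (use g in auto)
  have "(\<integral>\<omega>. exp (\<Sum>s<q * K. c (s mod K) * explored \<omega> s) \<partial>draws T) = (\<Prod>t\<in>{1..T}. expectation (g t))"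
    unfolding eq by (rule P.product_integral_prod) (use g in auto)
  also have "\<dots> = (\<Prod>k<T. if k < q * K then expectation (\<lambda>y. exp (c (k mod K) * Y (k mod K) y)) else 1)"
    unfolding One_nat_def prod.atLeast1_atMost_eq by (intro prod.cong refl) (auto simp: g_def[abs_def] prob_space)
  also have "\<dots> = (\<Prod>k<q * K. expectation (\<lambda>y. exp (c (k mod K) * Y (k mod K) y)))"
    by (rule restrict)
  also have "\<dots> \<le> (\<Prod>k<q * K. exp (c (k mod K) * mean (k mod K) + (c (k mod K))\<^sup>2 * M * mean (k mod K)))"
    by (intro prod_mono conjI exp_Y_integral_le c integral_nonneg_AE) auto
  also have "\<dots> = exp (\<Sum>k<q * K. c (k mod K) * mean (k mod K) + (c (k mod K))\<^sup>2 * M * mean (k mod K))"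
    by (simp add: exp_sum)
  also have "\<dots> = exp (real q * (\<Sum>a<K. c a * mean a + (c a)\<^sup>2 * M * mean a))"
    by (subst sum_periodic[of "\<lambda>a. c a * mean a + (c a)\<^sup>2 * M * mean a"]) simp
  also have "\<dots> \<le> 1" using drift by (simp add: mult_nonneg_nonpos)
  finally show ?le .
qed

section \<open>Bounds and measurability along the draws\<close>

lemma draws_bound: "AE \<omega> in draws T. \<forall>k<T. \<forall>a. 0 \<le> Y a (\<omega> (Suc k)) \<and> Y a (\<omega> (Suc k)) \<le> M"
proof -
  have "AE \<omega> in draws T. \<forall>t\<in>{1..T}. \<forall>a. 0 \<le> Y a (\<omega> t) \<and> Y a (\<omega> t) \<le> M"
    by (intro AE_finite_allI AE_PiM_component Y_bound prob_space_axioms) auto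
  then show ?thesis by eventually_elim auto
qed

lemma component_measurable: "k < T \<Longrightarrow> (\<lambda>\<omega>. \<omega> (Suc k)) \<in> draws T \<rightarrow>\<^sub>M D"
  by (rule measurable_component_singleton) simp

lemma explored_measurable: "k < T \<Longrightarrow> (\<lambda>\<omega>. explored \<omega> k) \<in> borel_measurable (draws T)"
  unfolding explored_def
  by (rule measurable_compose[OF component_measurable]) measurable

lemma choice_measurable:
  "k < T \<Longrightarrow> (\<lambda>\<omega>. arm_choice K B (explored \<omega>) k) \<in> draws T \<rightarrow>\<^sub>M count_space UNIV"
  by (rule arm_choice_measurable) (rule explored_measurable, simp)

lemma stopped_explored_measurable:
  "k < T \<Longrightarrow> Measurable.pred (draws T) (\<lambda>\<omega>. stopped K B (explored \<omega>) k)"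
  by (rule stopped_measurable) (rule explored_measurable, simp)

lemma paid_measurable:
  assumes "k < T"
  shows "(\<lambda>\<omega>. Y (arm_choice K B (explored \<omega>) k) (\<omega> (Suc k))) \<in> borel_measurable (draws T)"
  by (rule measurable_compose_countable[OF _ choice_measurable[OF assms]])
    (rule measurable_compose[OF component_measurable[OF assms]], measurable)

text \<open>The weights of the two arms compared are tilted against each other, and all arms get the same
  small positive weight. The tilt outweighs the positive weight in mean when arm \<open>i\<close> is bad.\<close>

lemma bad_arm_drift:
  assumes b: "b < K" and i: "i < K" and bad: "(1 + \<epsilon>) * mean b < mean i"
    and \<epsilon>: "0 \<le> \<epsilon>" and \<eta>: "0 \<le> \<eta>" and \<theta>: "0 \<le> \<theta>"
    and ratio: "\<And>a. mean a \<le> r * mean b"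
    and small: "(\<eta> + (\<theta> + \<eta>)\<^sup>2 * M) * real K * r \<le> \<theta> * \<epsilon>"
    and c: "\<And>a. c a = \<eta> + (if a = b then \<theta> else 0) - (if a = i then \<theta> else 0)"
  shows "(\<Sum>a<K. c a * mean a + (c a)\<^sup>2 * M * mean a) \<le> 0"
proof -
  have sq: "(c a)\<^sup>2 \<le> (\<theta> + \<eta>)\<^sup>2" for a
    by (rule abs_le_square_iff[THEN iffD1]) (use \<eta> \<theta> c in auto)
  have "(\<Sum>a<K. c a * mean a + (c a)\<^sup>2 * M * mean a)
      \<le> (\<Sum>a<K. (\<eta> + (\<theta> + \<eta>)\<^sup>2 * M) * mean a + (if a = b then \<theta> * mean a else 0)
            - (if a = i then \<theta> * mean a else 0))"
  proof (rule sum_mono)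
    fix a
    have "(c a)\<^sup>2 * M * mean a \<le> (\<theta> + \<eta>)\<^sup>2 * M * mean a"
      using sq M_pos mean_nonneg by (intro mult_right_mono) auto
    then show "c a * mean a + (c a)\<^sup>2 * M * mean a
        \<le> (\<eta> + (\<theta> + \<eta>)\<^sup>2 * M) * mean a + (if a = b then \<theta> * mean a else 0)
            - (if a = i then \<theta> * mean a else 0)"
      by (auto simp: c algebra_simps)
  qed
  also have "\<dots> = (\<eta> + (\<theta> + \<eta>)\<^sup>2 * M) * (\<Sum>a<K. mean a) + \<theta> * mean b - \<theta> * mean i"
    using b i by (simp add: sum.distrib sum_subtractf sum_distrib_left)
  also have "\<dots> \<le> (\<eta> + (\<theta> + \<eta>)\<^sup>2 * M) * (real K * (r * mean b)) + \<theta> * mean b - \<theta> * ((1 + \<epsilon>) * mean b)"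
  proof -
    have "(\<Sum>a<K. mean a) \<le> real (card {..<K}) * (r * mean b)"
      by (rule sum_bounded_above) (rule ratio)
    then have "(\<eta> + (\<theta> + \<eta>)\<^sup>2 * M) * (\<Sum>a<K. mean a) \<le> (\<eta> + (\<theta> + \<eta>)\<^sup>2 * M) * (real K * (r * mean b))"
      using \<eta> M_pos by (intro mult_left_mono) auto
    moreover have "\<theta> * ((1 + \<epsilon>) * mean b) \<le> \<theta> * mean i"
      using bad \<theta> by (intro mult_left_mono) auto
    ultimately show ?thesis by linarith
  qed
  \<comment> \<open>Every term carries the factor \<open>mean b\<close>, so the condition on
    \<open>\<eta>\<close> and \<open>\<theta>\<close> does not depend on how small the optimal cost
    is.\<close>
  also have "\<dots> = ((\<eta> + (\<theta> + \<eta>)\<^sup>2 * M) * real K * r - \<theta> * \<epsilon>) * mean b"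
    by (simp add: algebra_simps)
  also have "\<dots> \<le> 0" using small mean_nonneg by (intro mult_nonpos_nonneg) auto
  finally show ?thesis .
qed

section \<open>Expected total cost of exploring and committing\<close>

text \<open>Exploration is paid for along each path by \<open>exploration_cost_le\<close>. After
  stopping, the fresh draw costs on average the mean of the chosen arm, which is too large only for
  a bad arm; a sum of exponential weights dominates that event.\<close>

lemma total_cost_le:
  assumes b: "b < K" and \<epsilon>: "0 \<le> \<epsilon>" and \<eta>: "0 \<le> \<eta>" and \<theta>: "0 \<le> \<theta>" and B: "0 \<le> B"
    and ratio: "\<And>a. mean a \<le> r * mean b"
    and small: "(\<eta> + (\<theta> + \<eta>)\<^sup>2 * M) * real K * r \<le> \<theta> * \<epsilon>" "(\<theta> + \<eta>) * M \<le> 1"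
  shows "(\<Sum>k<T. \<integral>\<omega>. Y (arm_choice K B (explored \<omega>) k) (\<omega> (Suc k)) \<partial>draws T)
    \<le> B + real K * M + real T * ((1 + \<epsilon>) * mean b + M * (real T * real K * exp (- \<eta> * B)))"
proof -
  interpret P: prob_space "draws T" by (rule draws_prob_space)
  define c where "c i a = \<eta> + (if a = b then \<theta> else 0) - (if a = i then \<theta> else 0)" for i a
  define Bad where "Bad = {i. i < K \<and> (1 + \<epsilon>) * mean b < mean i}"
  \<comment> \<open>Markov's inequality in integrated form: for bad \<open>i\<close> the expectation
    is at most \<open>exp (- \<eta> * B)\<close>, while the value is at least 1 wherever the rule
    commits to \<open>i\<close> after round \<open>q\<close>.\<close>
  define W where "W q i \<omega> = exp (- \<eta> * B) * exp (\<Sum>s<q * K. c i (s mod K) * explored \<omega> s)" for q i \<omega>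
  define Q where "Q k = {q. q * K \<le> k}" for k
  \<comment> \<open>The union bound over possible stopping rounds and bad arms: \<open>G k\<close>
    dominates the indicator of having committed to a bad arm by time \<open>k\<close>.\<close>
  define G where "G k \<omega> = (\<Sum>q\<in>Q k. \<Sum>i\<in>Bad. W q i \<omega>)" for k \<omega>
  define ch where "ch k \<omega> = arm_choice K B (explored \<omega>) k" for k \<omega>
  define st where "st k \<omega> = stopped K B (explored \<omega>) k" for k \<omega>
  have st [measurable]: "Measurable.pred (draws T) (st k)" if "k < T" for k
    unfolding st_def using that by (rule stopped_explored_measurable)
  have ch [measurable]: "ch k \<in> draws T \<rightarrow>\<^sub>M count_space UNIV" if "k < T" for k
    unfolding ch_def using that by (rule choice_measurable)
  have paid [measurable]: "(\<lambda>\<omega>. Y (ch k \<omega>) (\<omega> (Suc k))) \<in> borel_measurable (draws T)" if "k < T" for k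
    unfolding ch_def using that by (rule paid_measurable)
  have expl [measurable]: "(\<lambda>\<omega>. explored \<omega> k) \<in> borel_measurable (draws T)" if "k < T" for k
    using that by (rule explored_measurable)
  have Qsub: "Q k \<subseteq> {..k}" for k
  proof
    fix q assume "q \<in> Q k"
    moreover have "q \<le> q * K" using K_pos by simp
    ultimately show "q \<in> {..k}" unfolding Q_def by (simp only: mem_Collect_eq atMost_iff)
  qed
  have Qfin: "finite (Q k)" for k using Qsub finite_subset by blast
  have Qcard: "card (Q k) \<le> T" if "k < T" for k
    using card_mono[OF _ Qsub[of k]] that by simp
  have Badfin: "finite Bad" and Badcard: "card Bad \<le> K"
    using card_mono[of "{..<K}" Bad] by (auto simp: Bad_def intro: finite_subset[of _ "{..<K}"])
  have c_abs: "\<bar>c i a\<bar> * M \<le> 1" for i a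
  proof -
    have "\<bar>c i a\<bar> * M \<le> (\<theta> + \<eta>) * M"
      using \<eta> \<theta> M_pos by (intro mult_right_mono) (auto simp: c_def)
    then show ?thesis using small(2) by simp
  qed
  have W: "integrable (draws T) (W q i)" "(\<integral>\<omega>. W q i \<omega> \<partial>draws T) \<le> exp (- \<eta> * B)"
    if "q \<in> Q k" "k < T" "i \<in> Bad" for q i k
  proof -
    have qT: "q * K \<le> T" using that by (simp add: Q_def)
    have drift: "(\<Sum>a<K. c i a * mean a + (c i a)\<^sup>2 * M * mean a) \<le> 0"
      using that by (intro bad_arm_drift[OF b _ _ \<epsilon> \<eta> \<theta> ratio small(1)]) (auto simp: Bad_def c_def)
    note e = exp_explored[OF qT c_abs drift]
    show "integrable (draws T) (W q i)" unfolding W_def using e(1) by simp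
    show "(\<integral>\<omega>. W q i \<omega> \<partial>draws T) \<le> exp (- \<eta> * B)" unfolding W_def using e(2) by simp
  qed
  have G_int: "integrable (draws T) (G k)" if "k < T" for k
    unfolding G_def using that by (intro Bochner_Integration.integrable_sum W(1))
  have G_le: "(\<integral>\<omega>. G k \<omega> \<partial>draws T) \<le> real T * real K * exp (- \<eta> * B)" if "k < T" for k
  proof -
    have "(\<integral>\<omega>. G k \<omega> \<partial>draws T) = (\<Sum>q\<in>Q k. \<Sum>i\<in>Bad. \<integral>\<omega>. W q i \<omega> \<partial>draws T)"
      unfolding G_def using W(1)[OF _ that]
      by (simp add: Bochner_Integration.integral_sum Bochner_Integration.integrable_sum)
    also have "\<dots> \<le> (\<Sum>q\<in>Q k. \<Sum>i\<in>Bad. exp (- \<eta> * B))"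
      by (intro sum_mono W(2)[OF _ that])
    also have "\<dots> = real (card (Q k)) * real (card Bad) * exp (- \<eta> * B)" by simp
    also have "\<dots> \<le> real T * real K * exp (- \<eta> * B)"
      using Qcard[OF that] Badcard by (intro mult_right_mono mult_mono) auto
    finally show ?thesis .
  qed
  \<comment> \<open>On a bad commitment \<open>G k\<close> is at least 1, so \<open>M * G k\<close>
    covers any mean. Otherwise the first summand suffices.\<close>
  have commit: "mean (ch k \<omega>) \<le> (1 + \<epsilon>) * mean b + M * G k \<omega>" if "st k \<omega>" for k \<omega>
  proof (cases "ch k \<omega> \<in> Bad")
    case False
    have "ch k \<omega> < K" unfolding ch_def using K_pos by (rule arm_choice_less)
    moreover have "0 \<le> G k \<omega>" unfolding G_def W_def by (intro sum_nonneg) simp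
    ultimately show ?thesis using False M_pos
      by (simp add: Bad_def not_less add_increasing2)
  next
    case True
    define q where "q = stop_round K B (explored \<omega>)"
    define i where "i = ch k \<omega>"
    have i: "i = best_arm K q (explored \<omega>)" "i < K"
      using that K_pos by (auto simp: i_def ch_def arm_choice_def q_def st_def best_arm_props)
    have q: "q \<in> Q k" "B \<le> (\<Sum>s<q * K. explored \<omega> s)"
      using stop_round_props[of K B "explored \<omega>" k] that by (auto simp: q_def st_def Q_def)
    have tot: "(\<Sum>s<q * K. if s mod K = a then explored \<omega> s else 0) = arm_total K q (explored \<omega>) a" for a
    proof -
      have "{s. s < q * K \<and> s mod K = a} = {s \<in> {..<q * K}. s mod K = a}" by auto
      then show ?thesis unfolding arm_total_def by (subst sum.inter_filter[symmetric]) auto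
    qed
    have "(\<Sum>s<q * K. c i (s mod K) * explored \<omega> s)
        = (\<Sum>s<q * K. \<eta> * explored \<omega> s + \<theta> * (if s mod K = b then explored \<omega> s else 0)
             - \<theta> * (if s mod K = i then explored \<omega> s else 0))"
      by (intro sum.cong refl) (auto simp: c_def algebra_simps)
    also have "\<dots> = \<eta> * (\<Sum>s<q * K. explored \<omega> s)
        + \<theta> * arm_total K q (explored \<omega>) b - \<theta> * arm_total K q (explored \<omega>) i"
      unfolding sum.distrib sum_subtractf tot[symmetric] sum_distrib_left ..
    \<comment> \<open>The explored total has reached \<open>B\<close>, and the tilt is nonnegative
      because \<open>i\<close> is empirically cheapest.\<close>
    also have "\<dots> \<ge> \<eta> * B"
    proof -
      have "\<theta> * arm_total K q (explored \<omega>) i \<le> \<theta> * arm_total K q (explored \<omega>) b"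
        unfolding i(1) using K_pos b \<theta> by (intro mult_left_mono best_arm_props) auto
      moreover have "\<eta> * B \<le> \<eta> * (\<Sum>s<q * K. explored \<omega> s)"
        using q(2) \<eta> by (rule mult_left_mono)
      ultimately show ?thesis by linarith
    qed
    finally have "exp (\<eta> * B) \<le> exp (\<Sum>s<q * K. c i (s mod K) * explored \<omega> s)" by simp
    then have "exp (- \<eta> * B) * exp (\<eta> * B) \<le> W q i \<omega>"
      unfolding W_def by (intro mult_left_mono) auto
    then have "1 \<le> W q i \<omega>" by (simp flip: exp_add)
    also have "\<dots> \<le> (\<Sum>i\<in>Bad. W q i \<omega>)"
      using True Badfin by (intro member_le_sum) (auto simp: i_def W_def)
    also have "\<dots> \<le> G k \<omega>"
      unfolding G_def using q(1) Qfin
      by (intro member_le_sum[where f="\<lambda>q. \<Sum>i\<in>Bad. W q i \<omega>"] sum_nonneg) (auto simp: W_def)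
    finally have "M * 1 \<le> M * G k \<omega>" using M_pos by (intro mult_left_mono) auto
    moreover have "0 \<le> (1 + \<epsilon>) * mean b" using \<epsilon> mean_nonneg by simp
    ultimately show ?thesis using mean_le[of "ch k \<omega>"] by linarith
  qed
  have expl_int: "integrable (draws T) (\<lambda>\<omega>. if st k \<omega> then 0 else explored \<omega> k)" if "k < T" for k
  proof (rule P.integrable_const_bound[where B=M])
    show "AE \<omega> in draws T. norm (if st k \<omega> then 0 else explored \<omega> k) \<le> M"
      using draws_bound[of T] by eventually_elim (use that M_pos in \<open>auto simp: explored_def\<close>)
    show "(\<lambda>\<omega>. if st k \<omega> then 0 else explored \<omega> k) \<in> borel_measurable (draws T)"
      using st[OF that] expl[OF that] by measurable
  qed
  have comm_int: "integrable (draws T) (\<lambda>\<omega>. if st k \<omega> then Y (ch k \<omega>) (\<omega> (Suc k)) else 0)" if "k < T" for k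
  proof (rule P.integrable_const_bound[where B=M])
    show "AE \<omega> in draws T. norm (if st k \<omega> then Y (ch k \<omega>) (\<omega> (Suc k)) else 0) \<le> M"
      using draws_bound[of T] by eventually_elim (use that M_pos in auto)
    show "(\<lambda>\<omega>. if st k \<omega> then Y (ch k \<omega>) (\<omega> (Suc k)) else 0) \<in> borel_measurable (draws T)"
      using st[OF that] paid[OF that] by measurable
  qed
  have mean_int: "integrable (draws T) (\<lambda>\<omega>. if st k \<omega> then mean (ch k \<omega>) else 0)" if "k < T" for k
  proof (rule P.integrable_const_bound[where B=M])
    show "AE \<omega> in draws T. norm (if st k \<omega> then mean (ch k \<omega>) else 0) \<le> M"
      using mean_nonneg mean_le M_pos by auto
    have "(\<lambda>\<omega>. mean (ch k \<omega>)) \<in> borel_measurable (draws T)"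
      by (rule measurable_compose[OF ch[OF that]]) simp
    then show "(\<lambda>\<omega>. if st k \<omega> then mean (ch k \<omega>) else 0) \<in> borel_measurable (draws T)"
      using st[OF that] by measurable
  qed
  have step: "(\<integral>\<omega>. Y (ch k \<omega>) (\<omega> (Suc k)) \<partial>draws T)
      \<le> (\<integral>\<omega>. (if st k \<omega> then 0 else explored \<omega> k) \<partial>draws T)
        + ((1 + \<epsilon>) * mean b + M * (real T * real K * exp (- \<eta> * B)))" if k: "k < T" for k
  proof -
    \<comment> \<open>Before stopping the chosen arm is \<open>k mod K\<close>, so the cost paid is
      \<open>explored \<omega> k\<close>.\<close>
    have "(\<integral>\<omega>. Y (ch k \<omega>) (\<omega> (Suc k)) \<partial>draws T)
        = (\<integral>\<omega>. (if st k \<omega> then 0 else explored \<omega> k)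
              + (if st k \<omega> then Y (ch k \<omega>) (\<omega> (Suc k)) else 0) \<partial>draws T)"
      by (intro Bochner_Integration.integral_cong refl)
        (auto simp: ch_def st_def arm_choice_def explored_def)
    also have "\<dots> = (\<integral>\<omega>. (if st k \<omega> then 0 else explored \<omega> k) \<partial>draws T)
        + (\<integral>\<omega>. (if st k \<omega> then Y (ch k \<omega>) (\<omega> (Suc k)) else 0) \<partial>draws T)"
      by (rule Bochner_Integration.integral_add[OF expl_int[OF k] comm_int[OF k]])
    also have "(\<integral>\<omega>. (if st k \<omega> then Y (ch k \<omega>) (\<omega> (Suc k)) else 0) \<partial>draws T)
        = (\<integral>\<omega>. (if st k \<omega> then mean (ch k \<omega>) else 0) \<partial>draws T)"
    proof -
      define F where "F \<omega> y = (if st k \<omega> then Y (ch k \<omega>) y else 0)" for \<omega> y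
      have F_mean: "(\<integral>y. F \<omega> y \<partial>D) = (if st k \<omega> then mean (ch k \<omega>) else 0)" for \<omega>
        by (simp add: F_def mean_def)
      \<comment> \<open>Both the stopping decision and the chosen arm depend only on periods up to
        \<open>k\<close>, so draw \<open>Suc k\<close> is fresh.\<close>
      have "F (x(Suc k := z)) y = F x y" for x y z
      proof -
        have e: "explored (x(Suc k := z)) i = explored x i" if "i < k" for i
          using that by (simp add: explored_def)
        have "st k (x(Suc k := z)) = st k x"
          unfolding st_def using e by (intro stopped_cong) simp
        moreover have "ch k (x(Suc k := z)) = ch k x"
          unfolding ch_def using e by (intro arm_choice_adaptive) simp
        ultimately show ?thesis by (simp add: F_def)
      qed
      then show ?thesis
        using integral_PiM_fresh_coordinate[OF prob_space_axioms, of "{1..T}" "Suc k" F]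
          comm_int[OF k] mean_int[OF k] k
        by (simp add: F_mean) (simp add: F_def)
    qed
    also have "\<dots> \<le> (\<integral>\<omega>. (1 + \<epsilon>) * mean b + M * G k \<omega> \<partial>draws T)"
    proof (rule integral_mono[OF mean_int[OF k]])
      show "(if st k \<omega> then mean (ch k \<omega>) else 0) \<le> (1 + \<epsilon>) * mean b + M * G k \<omega>" for \<omega>
      proof -
        have "0 \<le> G k \<omega>" unfolding G_def W_def by (intro sum_nonneg) simp
        then have "0 \<le> (1 + \<epsilon>) * mean b + M * G k \<omega>"
          using \<epsilon> M_pos mean_nonneg by simp
        then show ?thesis using commit by simp
      qed
      show "integrable (draws T) (\<lambda>\<omega>. (1 + \<epsilon>) * mean b + M * G k \<omega>)"
        by (intro Bochner_Integration.integrable_add Bochner_Integration.integrable_mult_right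
            P.integrable_const G_int[OF k])
    qed
    also have "\<dots> = (1 + \<epsilon>) * mean b + M * (\<integral>\<omega>. G k \<omega> \<partial>draws T)"
      using G_int[OF k] by (simp add: P.prob_space del: One_nat_def)
    also have "\<dots> \<le> (1 + \<epsilon>) * mean b + M * (real T * real K * exp (- \<eta> * B))"
      using G_le[OF k] M_pos by (intro add_left_mono mult_left_mono) auto
    finally show ?thesis by simp
  qed
  \<comment> \<open>The number of exploring periods is random and can be large when costs are small.
    The sum is therefore bounded along each path before integrating.\<close>
  have explore: "(\<Sum>k<T. \<integral>\<omega>. (if st k \<omega> then 0 else explored \<omega> k) \<partial>draws T) \<le> B + real K * M"
  proof -
    have "(\<Sum>k<T. \<integral>\<omega>. (if st k \<omega> then 0 else explored \<omega> k) \<partial>draws T)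
        = (\<integral>\<omega>. (\<Sum>k<T. if st k \<omega> then 0 else explored \<omega> k) \<partial>draws T)"
      by (rule Bochner_Integration.integral_sum[symmetric]) (use expl_int in auto)
    also have "\<dots> \<le> (\<integral>\<omega>. B + real K * M \<partial>draws T)"
    proof (rule integral_mono_AE)
      show "AE \<omega> in draws T. (\<Sum>k<T. if st k \<omega> then 0 else explored \<omega> k) \<le> B + real K * M"
        using draws_bound[of T]
        by eventually_elim
          (unfold st_def, rule exploration_cost_le, use K_pos B M_pos in \<open>auto simp: explored_def\<close>)
    qed (use expl_int in \<open>auto simp del: One_nat_def\<close>)
    finally show ?thesis by (simp add: P.prob_space del: One_nat_def)
  qed
  have "(\<Sum>k<T. \<integral>\<omega>. Y (ch k \<omega>) (\<omega> (Suc k)) \<partial>draws T)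
      \<le> (\<Sum>k<T. (\<integral>\<omega>. (if st k \<omega> then 0 else explored \<omega> k) \<partial>draws T)
        + ((1 + \<epsilon>) * mean b + M * (real T * real K * exp (- \<eta> * B))))"
    by (rule sum_mono) (rule step, simp)
  also have "\<dots> \<le> B + real K * M + real T * ((1 + \<epsilon>) * mean b + M * (real T * real K * exp (- \<eta> * B)))"
    using explore by (simp add: sum.distrib)
  finally show ?thesis by (simp add: ch_def)
qed

end

subsection \<open>Schedules as arms\<close>

text \<open>Every natural number yields a schedule, and the indices below the number of schedules
  already reach all of them.\<close>

definition arm :: "nat \<Rightarrow> nat \<Rightarrow> schedule" where
  "arm n = from_nat_into (schedules n)"

text \<open>While exploring, the position of a cost in the history tells which arm it belongs to.
  The default 0 only makes the sequence total: the choice at time \<open>length h\<close> does not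
  depend on later entries.\<close>

definition explore_then_commit :: "nat \<Rightarrow> real \<Rightarrow> nat \<Rightarrow> history \<Rightarrow> schedule" where
  "explore_then_commit n \<beta> T h =
     arm n (arm_choice (card (schedules n)) (\<beta> * ln (real T))
       (\<lambda>s. if s < length h then snd (h ! s) else 0) (length h))"

lemma finite_schedules: "finite (schedules n)"
  unfolding schedules_def by (rule finite_permutations) simp

lemma schedules_nonempty: "schedules n \<noteq> {}"
  using permutes_id[of "{1..n}"] unfolding schedules_def by blast

lemma card_schedules_pos: "card (schedules n) > 0"
  using finite_schedules schedules_nonempty by (simp add: card_gt_0_iff)

lemma arm_in_schedules: "arm n i \<in> schedules n"
  unfolding arm_def by (rule from_nat_into[OF schedules_nonempty])

lemma bandit_algorithm_explore_then_commit: "bandit_algorithm n (explore_then_commit n \<beta>)"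
  unfolding bandit_algorithm_def
proof (intro allI impI)
  fix T k :: nat and \<sigma> :: "nat \<Rightarrow> schedule"
  let ?N = "Pi\<^sub>M {..<k} (\<lambda>_. borel :: real measure)"
  define W where "W c s = (if s < k then c s else 0)" for c :: "nat \<Rightarrow> real" and s
  have "(\<lambda>c. W c s) \<in> borel_measurable ?N" for s
    unfolding W_def by (cases "s < k") auto
  then have "(\<lambda>c. arm_choice (card (schedules n)) (\<beta> * ln (real T)) (W c) k) \<in> ?N \<rightarrow>\<^sub>M count_space UNIV"
    by (intro arm_choice_measurable)
  moreover have "arm n \<in> count_space UNIV \<rightarrow>\<^sub>M count_space (schedules n)"
    using arm_in_schedules by simp
  ultimately have "(\<lambda>c. arm n (arm_choice (card (schedules n)) (\<beta> * ln (real T)) (W c) k))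
      \<in> ?N \<rightarrow>\<^sub>M count_space (schedules n)"
    by (rule measurable_compose)
  moreover have "(\<lambda>s. if s < k then snd (map (\<lambda>i. (\<sigma> i, c i)) [0..<k] ! s) else 0) = W c" for c
    by (auto simp: W_def)
  ultimately show "(\<lambda>c. explore_then_commit n \<beta> T (map (\<lambda>i. (\<sigma> i, c i)) [0..<k]))
      \<in> ?N \<rightarrow>\<^sub>M count_space (schedules n)"
    unfolding explore_then_commit_def by (simp cong: if_cong)
qed

text \<open>After commitment the observed costs come from the committed arm instead of round robin.
  By \<open>arm_choice_adaptive\<close> this does not affect the choice, so the play is a function
  of the idealized round-robin costs.\<close>

lemma schedule_at_explore_then_commit:
  "schedule_at n (explore_then_commit n \<beta> T) \<omega> (Suc k) =
     arm n (arm_choice (card (schedules n)) (\<beta> * ln (real T))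
       (\<lambda>s. cost n (arm n (s mod card (schedules n))) (\<omega> (Suc s))) k)"
proof -
  define K where "K = card (schedules n)"
  define B where "B = \<beta> * ln (real T)"
  define X where "X s = cost n (arm n (s mod K)) (\<omega> (Suc s))" for s
  define p where "p s = arm n (arm_choice K B X s)" for s
  define c where "c s = cost n (p s) (\<omega> (Suc s))" for s
  have next_arm: "explore_then_commit n \<beta> T (map (\<lambda>s. (p s, c s)) [0..<k]) = p k" for k
  proof -
    have "arm_choice K B (\<lambda>s. if s < k then snd (map (\<lambda>s. (p s, c s)) [0..<k] ! s) else 0) k
        = arm_choice K B X k"
      by (rule arm_choice_adaptive) (simp add: c_def p_def X_def arm_choice_def)
    then show ?thesis by (simp add: explore_then_commit_def p_def K_def B_def cong: if_cong)
  qed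
  have "run n (explore_then_commit n \<beta> T) \<omega> k = map (\<lambda>s. (p s, c s)) [0..<k]" for k
    by (induction k) (simp_all add: next_arm Let_def c_def[symmetric])
  then show ?thesis
    using next_arm by (simp add: schedule_at_def p_def K_def B_def X_def[abs_def])
qed

section \<open>Completion times as bounded arm costs, and the regret bound\<close>

text \<open>In the weighted form each coefficient n - \<pi>(j) + 1 lies between 1 and n. Hence the
  costs of any two schedules differ by a factor of at most n.\<close>

lemma cost_bounds:
  assumes \<pi>: "\<pi> \<in> schedules n" and P: "\<And>j. j \<in> {1..n} \<Longrightarrow> 0 \<le> P j"
  shows "(\<Sum>j=1..n. P j) \<le> cost n \<pi> P" "cost n \<pi> P \<le> real n * (\<Sum>j=1..n. P j)"
proof -
  have \<pi>j: "1 \<le> \<pi> j \<and> \<pi> j \<le> n" if "j \<in> {1..n}" for j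
    using permutes_in_image[of \<pi> "{1..n}" j] \<pi> that by (auto simp: schedules_def)
  have "(\<Sum>j=1..n. 1 * P j) \<le> (\<Sum>j=1..n. (real n - real (\<pi> j) + 1) * P j)"
    by (intro sum_mono mult_right_mono P) (use \<pi>j in auto)
  then show "(\<Sum>j=1..n. P j) \<le> cost n \<pi> P" using cost_eq_weighted_sum[OF \<pi>] by simp
  have "(\<Sum>j=1..n. (real n - real (\<pi> j) + 1) * P j) \<le> (\<Sum>j=1..n. real n * P j)"
    by (intro sum_mono mult_right_mono P) (use \<pi>j in fastforce)+
  then show "cost n \<pi> P \<le> real n * (\<Sum>j=1..n. P j)"
    using cost_eq_weighted_sum[OF \<pi>] by (simp add: sum_distrib_left)
qed

lemma round_robin_cost:
  assumes n: "n \<ge> 1" and D: "size_distribution n D"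
  shows "round_robin D (\<lambda>a. cost n (arm n a)) (real n ^ 2) (card (schedules n))"
proof -
  interpret prob_space D using D by (simp add: size_distribution_def)
  have sets: "sets D = sets (Pi\<^sub>M {1..n} (\<lambda>_. borel))" using D by (simp add: size_distribution_def)
  have cube: "AE P in D. \<forall>j\<in>{1..n}. 0 \<le> P j \<and> P j \<le> 1" using D by (simp add: size_distribution_def)
  show ?thesis
  proof
    show "card (schedules n) > 0" by (rule card_schedules_pos)
    show "real n ^ 2 > 0" using n by simp
    show "cost n (arm n a) \<in> borel_measurable D" for a
    proof -
      have "cost n (arm n a) = (\<lambda>P. \<Sum>j=1..n. (real n - real (arm n a j) + 1) * P j)"
        using cost_eq_weighted_sum[OF arm_in_schedules] by blast
      then show ?thesis unfolding measurable_cong_sets[OF sets refl] by simp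
    qed
    show "AE P in D. \<forall>a. 0 \<le> cost n (arm n a) P \<and> cost n (arm n a) P \<le> real n ^ 2"
      using cube
    proof (eventually_elim, intro allI)
      fix P a assume P: "\<forall>j\<in>{1..n}. 0 \<le> P j \<and> P j \<le> (1::real)"
      have "(\<Sum>j=1..n. P j) \<le> real (card {1..n}) * 1" by (rule sum_bounded_above) (use P in auto)
      then have "real n * (\<Sum>j=1..n. P j) \<le> real n * real n" by (intro mult_left_mono) auto
      moreover have "0 \<le> (\<Sum>j=1..n. P j)" by (rule sum_nonneg) (use P in auto)
      ultimately show "0 \<le> cost n (arm n a) P \<and> cost n (arm n a) P \<le> real n ^ 2"
        using cost_bounds[OF arm_in_schedules, of n P a] P by (force simp: power2_eq_square)
    qed
  qed
qed

lemma regret_explore_then_commit_le: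
  assumes n: "n \<ge> 1" and D: "size_distribution n D" and T: "T \<ge> 1"
    and \<epsilon>: "0 \<le> \<epsilon>" and \<eta>: "0 < \<eta>" and \<theta>: "0 \<le> \<theta>"
    and small: "(\<eta> + (\<theta> + \<eta>)\<^sup>2 * real n ^ 2) * real (card (schedules n)) * real n \<le> \<theta> * \<epsilon>"
      "(\<theta> + \<eta>) * real n ^ 2 \<le> 1"
  shows "regret n (1 + \<epsilon>) (explore_then_commit n (2 / \<eta>)) D T
    \<le> 2 / \<eta> * ln (real T) + 2 * real (card (schedules n)) * real n ^ 2"
proof -
  define K where "K = card (schedules n)"
  define B where "B = 2 / \<eta> * ln (real T)"
  interpret round_robin D "\<lambda>a. cost n (arm n a)" "real n ^ 2" K
    unfolding K_def by (rule round_robin_cost[OF n D])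
  have cube: "AE P in D. \<forall>j\<in>{1..n}. 0 \<le> P j \<and> P j \<le> 1" using D by (simp add: size_distribution_def)
  have ratio: "mean a \<le> real n * mean b" for a b
  proof -
    have "mean a \<le> expectation (\<lambda>P. real n * cost n (arm n b) P)"
      unfolding mean_def
    proof (rule integral_mono_AE)
      show "AE P in D. cost n (arm n a) P \<le> real n * cost n (arm n b) P"
        using cube
      proof eventually_elim
        case (elim P)
        then have "cost n (arm n a) P \<le> real n * (\<Sum>j=1..n. P j)"
          by (intro cost_bounds arm_in_schedules) auto
        also have "\<dots> \<le> real n * cost n (arm n b) P"
          using elim by (intro mult_left_mono cost_bounds arm_in_schedules) auto
        finally show ?case .
      qed
    qed (use Y_integrable in auto)
    then show ?thesis by (simp add: mean_def)
  qed
  obtain b where b: "b < K" "mean b = opt n D"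
  proof -
    have "opt n D \<in> (\<lambda>\<pi>. \<integral>P. cost n \<pi> P \<partial>D) ` schedules n"
      unfolding opt_def using finite_schedules schedules_nonempty by (intro Min_in) auto
    then obtain \<pi> where \<pi>: "\<pi> \<in> schedules n" "opt n D = (\<integral>P. cost n \<pi> P \<partial>D)" by auto
    have "\<pi> \<in> arm n ` {..<K}"
      using bij_betw_from_nat_into_finite[OF finite_schedules, of n] \<pi>(1)
      unfolding arm_def K_def by (simp add: bij_betw_def)
    then show ?thesis using that \<pi>(2) by (auto simp: mean_def)
  qed
  have B: "0 \<le> B" using \<eta> T by (simp add: B_def)
  \<comment> \<open>The factor 2 in \<open>B\<close> yields T^(-2): one T pays for the candidate
    stopping rounds, the other for the periods in which a bad arm may be played. What remains is a
    second term \<open>real K * real n ^ 2\<close>.\<close>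
  have "exp (- \<eta> * B) = exp (- ln (real T)) * exp (- ln (real T))"
    using \<eta> by (simp add: B_def flip: exp_add)
  also have "\<dots> = 1 / (real T * real T)" using T by (simp add: exp_minus divide_simps)
  finally have tail: "real T * real T * exp (- \<eta> * B) = 1" using T by simp
  have "(\<Sum>t=1..T. \<integral>\<omega>. cost n (schedule_at n (explore_then_commit n (2 / \<eta>) T) \<omega> t) (\<omega> t) \<partial>draws T)
      = (\<Sum>k<T. \<integral>\<omega>. cost n (arm n (arm_choice K B (explored \<omega>) k)) (\<omega> (Suc k)) \<partial>draws T)"
    unfolding One_nat_def sum.atLeast1_atMost_eq schedule_at_explore_then_commit
      explored_def[abs_def] K_def[symmetric] B_def[symmetric] ..
  also have "\<dots> \<le> B + real K * real n ^ 2
      + real T * ((1 + \<epsilon>) * mean b + real n ^ 2 * (real T * real K * exp (- \<eta> * B)))"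
    using \<eta> small by (intro total_cost_le[OF b(1) \<epsilon> _ \<theta> B ratio]) (auto simp: K_def)
  also have "\<dots> = B + real K * real n ^ 2 + (1 + \<epsilon>) * real T * mean b
      + real n ^ 2 * real K * (real T * real T * exp (- \<eta> * B))"
    by (simp add: algebra_simps)
  finally show ?thesis unfolding regret_def tail b(2) by (simp add: B_def K_def algebra_simps)
qed

section \<open>Choice of constants and conclusion\<close>

lemma linear_le_cube_eventually:
  fixes a b d :: real
  assumes "0 \<le> a" "0 \<le> b" "0 < d"
  shows "\<exists>T0. \<forall>T::nat. T \<ge> T0 \<longrightarrow> T \<ge> 1 \<and> a * ln (real T) + b \<le> d * ln (real T) ^ 3"
proof (intro exI allI impI)
  fix T :: nat
  define L where "L = max 1 ((a + b) / d)"
  \<comment> \<open>The threshold left open by \<open>exI\<close> is fixed here. It forces x = ln T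
    to be at least 1 and at least (a + b) / d, so that a x + b \<le> (a + b) x \<le> d x^2 \<le> d
    x^3.\<close>
  assume T: "T \<ge> nat \<lceil>exp (max 1 ((a + b) / d))\<rceil>"
  then have eT: "exp L \<le> real T" unfolding L_def by linarith
  then have T0: "0 < real T" by (rule less_le_trans[OF exp_gt_zero])
  define x where "x = ln (real T)"
  have "L \<le> x" unfolding x_def using eT T0 by (simp add: ln_ge_iff)
  then have x: "1 \<le> x" "(a + b) / d \<le> x" by (auto simp: L_def)
  have "a * x + b * 1 \<le> a * x + b * x" using x assms by (intro add_left_mono mult_left_mono) auto
  also have "\<dots> = (a + b) * x" by (simp add: algebra_simps)
  also have "\<dots> \<le> (d * x) * x" using x assms by (intro mult_right_mono) (auto simp: field_simps)
  also have "\<dots> = d * x ^ 2" by (simp add: power2_eq_square)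
  also have "\<dots> \<le> d * x ^ 3" using x assms by (intro mult_left_mono power_increasing) auto
  finally show "T \<ge> 1 \<and> a * ln (real T) + b \<le> d * ln (real T) ^ 3" using T0 by (simp add: x_def)
qed

text \<open>Take \<open>\<eta> = \<theta> * \<kappa>\<close> with \<kappa> \<le> 1. The bound on
  \<open>\<kappa>\<close> keeps the linear term below half of \<open>\<theta> * \<epsilon>\<close>;
  the bounds on \<open>\<theta>\<close> do the same for the quadratic term and keep the exponents in
  the range of \<open>exp_le_quadratic\<close>.\<close>

lemma tilts_exist:
  fixes \<epsilon> M L :: real
  assumes "0 < \<epsilon>" "0 < M" "0 < L"
  shows "\<exists>\<eta> \<theta>. 0 < \<eta> \<and> 0 \<le> \<theta> \<and> (\<eta> + (\<theta> + \<eta>)\<^sup>2 * M) * L \<le> \<theta> * \<epsilon> \<and> (\<theta> + \<eta>) * M \<le> 1"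
proof -
  define \<kappa> where "\<kappa> = min 1 (\<epsilon> / (2 * L))"
  define \<theta> where "\<theta> = min (1 / (2 * M)) (\<epsilon> / (8 * M * L))"
  have \<kappa>: "0 < \<kappa>" "\<kappa> \<le> 1" "\<kappa> \<le> \<epsilon> / (2 * L)" using assms by (auto simp: \<kappa>_def)
  have \<theta>: "0 < \<theta>" "\<theta> \<le> 1 / (2 * M)" "\<theta> \<le> \<epsilon> / (8 * M * L)" using assms by (auto simp: \<theta>_def)
  have \<kappa>L: "\<kappa> * L \<le> \<epsilon> / 2" using \<kappa>(3) assms by (simp add: field_simps)
  have \<theta>M: "\<theta> * M \<le> 1 / 2" using \<theta>(2) assms by (simp add: field_simps)
  have \<theta>L: "4 * \<theta> * (M * L) \<le> \<epsilon> / 2" using \<theta>(3) assms by (simp add: field_simps)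
  have sum: "\<theta> + \<theta> * \<kappa> \<le> 2 * \<theta>" using \<kappa> \<theta> by simp
  have "(\<theta> + \<theta> * \<kappa>)\<^sup>2 * (M * L) \<le> (2 * \<theta>)\<^sup>2 * (M * L)"
    using sum \<kappa> \<theta> assms by (intro mult_right_mono power_mono) auto
  also have "\<dots> = \<theta> * (4 * \<theta> * (M * L))" by (simp add: power2_eq_square)
  also have "\<dots> \<le> \<theta> * (\<epsilon> / 2)" using \<theta>L \<theta> by (intro mult_left_mono) auto
  finally have 1: "(\<theta> + \<theta> * \<kappa>)\<^sup>2 * (M * L) \<le> \<theta> * (\<epsilon> / 2)" .
  have 2: "\<theta> * (\<kappa> * L) \<le> \<theta> * (\<epsilon> / 2)" using \<kappa>L \<theta> by (intro mult_left_mono) auto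
  have "(\<theta> * \<kappa> + (\<theta> + \<theta> * \<kappa>)\<^sup>2 * M) * L \<le> \<theta> * \<epsilon>"
    using 1 2 by (simp add: algebra_simps)
  moreover have "(\<theta> + \<theta> * \<kappa>) * M \<le> 2 * \<theta> * M" using sum assms by (intro mult_right_mono) auto
  ultimately show ?thesis
    using \<theta>M \<kappa> \<theta> by (intro exI[of _ "\<theta> * \<kappa>"] exI[of _ \<theta>]) auto
qed

theorem corollary4p3:
  "\<exists>C::real. C > 0 \<and>
     (\<forall>(n::nat) (\<epsilon>::real). n \<ge> 1 \<longrightarrow> \<epsilon> > 0 \<longrightarrow>
       (\<exists>A. bandit_algorithm n A \<and>
         (\<exists>T0::nat. \<forall>D. size_distribution n D \<longrightarrow>
           (\<forall>T\<ge>T0. regret n (1 + \<epsilon>) A D T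
              \<le> C * (real n ^ 12 * (ln (real T)) ^ 3 / \<epsilon> ^ 4)))))"
proof (intro exI[of _ "1::real"] conjI allI impI)
  fix n :: nat and \<epsilon> :: real
  assume n: "n \<ge> 1" and \<epsilon>: "\<epsilon> > 0"
  define K where "K = card (schedules n)"
  have K: "K > 0" unfolding K_def by (rule card_schedules_pos)
  obtain \<eta> \<theta> where \<eta>: "0 < \<eta>" and \<theta>: "0 \<le> \<theta>"
    and small: "(\<eta> + (\<theta> + \<eta>)\<^sup>2 * real n ^ 2) * (real K * real n) \<le> \<theta> * \<epsilon>" "(\<theta> + \<eta>) * real n ^ 2 \<le> 1"
    using tilts_exist[of \<epsilon> "real n ^ 2" "real K * real n"] n \<epsilon> K by auto
  \<comment> \<open>\<open>K\<close> and \<open>2 / \<eta>\<close> may be huge, but they depend only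
    on \<open>n\<close> and \<open>\<epsilon>\<close>. The cube of the logarithm eventually absorbs
    them, uniformly in \<open>D\<close>, which is why the absolute constant can be 1.\<close>
  obtain T0 where T0: "\<And>T::nat. T \<ge> T0 \<Longrightarrow> T \<ge> 1 \<and>
      2 / \<eta> * ln (real T) + 2 * real K * real n ^ 2 \<le> real n ^ 12 / \<epsilon> ^ 4 * ln (real T) ^ 3"
    using linear_le_cube_eventually[of "2 / \<eta>" "2 * real K * real n ^ 2" "real n ^ 12 / \<epsilon> ^ 4"] n \<epsilon> \<eta>
    by auto
  show "\<exists>A. bandit_algorithm n A \<and> (\<exists>T0::nat. \<forall>D. size_distribution n D \<longrightarrow>
      (\<forall>T\<ge>T0. regret n (1 + \<epsilon>) A D T \<le> 1 * (real n ^ 12 * (ln (real T)) ^ 3 / \<epsilon> ^ 4)))"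
  proof (intro exI[of _ "explore_then_commit n (2 / \<eta>)"] exI[of _ T0] conjI allI impI
      bandit_algorithm_explore_then_commit)
    fix D T assume D: "size_distribution n D" and T: "T \<ge> T0"
    have "regret n (1 + \<epsilon>) (explore_then_commit n (2 / \<eta>)) D T
        \<le> 2 / \<eta> * ln (real T) + 2 * real K * real n ^ 2"
      unfolding K_def
      by (rule regret_explore_then_commit_le[OF n D _ _ \<eta> \<theta>])
        (use T0[OF T] \<epsilon> small in \<open>auto simp: K_def mult.assoc\<close>)
    also have "\<dots> \<le> real n ^ 12 / \<epsilon> ^ 4 * ln (real T) ^ 3" using T0[OF T] by simp
    finally show "regret n (1 + \<epsilon>) (explore_then_commit n (2 / \<eta>)) D T
        \<le> 1 * (real n ^ 12 * (ln (real T)) ^ 3 / \<epsilon> ^ 4)" by simp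
  qed
qed simp

end
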